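(* Let $\mathcal{L}=[0,1]$ and $G=C^{\infty}(\mathcal{L},\mathrm{SE}(3))$. Let $m:\mathcal{L}\to\mathbb{R}^{*}_{+}$ be a mass measure, with value at $z$ denoted $m_z$, and for each $z\in\mathcal{L}$ let $I_z:\mathbb{R}^3\to\mathbb{R}^3$ be a positive definite inertia operator, i.e. $(v,I_z(v))>0$ for all $v\neq 0$. Let $p_0:\mathcal{L}\to\mathbb{R}^3$ be the smooth base map of a fixed reference configuration $P_0$. For every $\mathbf{g}\in G$, define on the tangent space $T_{\mathbf{g}}G$ the bilinear form $$\ll\delta\mathbf{g}_1,\delta\mathbf{g}_2\gg_{\mathbf{g}}=\int_{\mathcal{L}}m_z\bigl(\theta_L(\delta\mathbf{g}_1)(z)(p_0(z)),\theta_L(\delta\mathbf{g}_2)(z)(p_0(z))\bigr)+\bigl(\omega_{\theta_L(\delta\mathbf{g}_1)(z)},I_z(\omega_{\theta_L(\delta\mathbf{g}_2)(z)})\bigr)\,dz$$ for each $\delta\mathbf{g}_1,\delta\mathbf{g}_2\in T_{\mathbf{g}}G$. Then this is a Riemannian metric on $G$, and it is left invariant, that is, $$\ll\delta\mathbf{g}_1,\delta\mathbf{g}_2\gg_{\mathbf{g}}=\ll\theta_L(\delta\mathbf{g}_1),\theta_L(\delta\mathbf{g}_2)\gg_{\mathbf{e}},$$ where $\mathbf{e}$ is the neutral element of $G$.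
   Context: $(\cdot,\cdot)$ is the canonical scalar product on $\mathbb{R}^3$. $\mathrm{SE}(3)$ is the group of matrices $\begin{pmatrix}R&u\\0&1\end{pmatrix}$ with $R\in\mathrm{SO}(3)$, $u\in\mathbb{R}^3$, and its Lie algebra is $\mathfrak{se}(3)=\left\{\begin{pmatrix}j(\omega)&v\\0&0\end{pmatrix}:\omega,v\in\mathbb{R}^3\right\}$, where $j(\omega)$ is the skew-symmetric matrix with $j(\omega)x=\omega\times x$ for all $x\in\mathbb{R}^3$. For $V=\begin{pmatrix}j(\omega)&v\\0&0\end{pmatrix}\in\mathfrak{se}(3)$, write $\omega_V=\omega$, and for $x\in\mathbb{R}^3$ write $V(x)=\omega\times x+v$. $G=C^\infty(\mathcal{L},\mathrm{SE}(3))$ is an infinite-dimensional Lie group under pointwise multiplication and inversion, with Lie algebra $\mathfrak{G}=C^\infty(\mathcal{L},\mathfrak{se}(3))$ and neutral element $\mathbf{e}$ the constant function equal to the identity matrix $I_4$. Its tangent space at $\mathbf{g}$ is $T_{\mathbf{g}}G=\{\delta\mathbf{g}\in C^\infty(\mathcal{L},T\mathrm{SE}(3)):\delta\mathbf{g}(z)\in T_{\mathbf{g}(z)}\mathrm{SE}(3)\ \forall z\in\mathcal{L}\}$. The left Maurer–Cartan form is $\theta_L(\delta\mathbf{g})=(d(L_{\mathbf{g}})_{\mathbf{e}})^{-1}(\delta\mathbf{g})\in\mathfrak{G}$, where $L_{\mathbf{g}}$ is left multiplication by $\mathbf{g}$; concretely, $\theta_L(\delta\mathbf{g})(z)=\mathbf{g}(z)^{-1}\delta\mathbf{g}(z)$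 (matrix product). A reference configuration is a fixed map $P_0(z,r)=(p_0(z),Q_z(r))$ from the trivial principal bundle $\mathcal{L}\times\mathrm{SO}(3)$ to the frame bundle of $\mathbb{R}^3$, covering a smooth map $p_0:\mathcal{L}\to\mathbb{R}^3$ and right equivariant, i.e. $P_0(z,qr)=(p_0(z),Q_z(q)r)$. Only its base map $p_0$ enters the formula.
   Formalization: The inertia operators I_z are also assumed symmetric (otherwise the form need not be symmetric, e.g. I_z = Id + j(e_1)), and m_z and I_z(v) are assumed Lebesgue integrable in z, without which the integral is undefined. *)

theory Defs
  imports "HOL-Analysis.Analysis"
begin

section \<open>Smooth functions of one real variable\<close>

definition deriv_on :: "real set \<Rightarrow> (real \<Rightarrow> 'a::real_normed_vector) \<Rightarrow> real \<Rightarrow> 'a" where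
  "deriv_on S f = (\<lambda>t. vector_derivative f (at t within S))"

text \<open>On a compact interval the derivatives at the endpoints are the one-sided ones.\<close>

definition smooth_on :: "real set \<Rightarrow> (real \<Rightarrow> 'a::real_normed_vector) \<Rightarrow> bool" where
  "smooth_on S f \<longleftrightarrow> (\<forall>n. ((deriv_on S ^^ n) f) differentiable_on S)"

lemma smooth_on_family:
  assumes D: "\<And>n z. z \<in> {0..1} \<Longrightarrow> (D n has_vector_derivative D (Suc n) z) (at z within {0..1})"
  shows "smooth_on {0..1} (D 0)"
    and "z \<in> {0..1} \<Longrightarrow> (deriv_on {0..1} ^^ n) (D 0) z = D n z"
proof -
  have not_bot: "at z within {0..1} \<noteq> bot" if "z \<in> {0..1}" for z :: real
    using that islimpt_Icc[of 0 1 z] by (simp add: trivial_limit_within)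
  have eq: "\<forall>z\<in>{0..1}. (deriv_on {0..1} ^^ n) (D 0) z = D n z" for n
  proof (induction n)
    case (Suc n)
    show ?case
    proof
      fix z :: real
      assume z: "z \<in> {0..1}"
      have "((deriv_on {0..1} ^^ n) (D 0) has_vector_derivative D (Suc n) z) (at z within {0..1})"
        using z Suc by (intro has_vector_derivative_transform[OF z _ D[OF z]]) auto
      then show "(deriv_on {0..1} ^^ Suc n) (D 0) z = D (Suc n) z"
        using not_bot[OF z] by (simp add: deriv_on_def vector_derivative_within)
    qed
  qed simp
  then show "z \<in> {0..1} \<Longrightarrow> (deriv_on {0..1} ^^ n) (D 0) z = D n z"
    by blast
  show "smooth_on {0..1} (D 0)"
    unfolding smooth_on_def differentiable_on_def
  proof (intro allI ballI)
    fix n and z :: real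
    assume z: "z \<in> {0..1}"
    have "((deriv_on {0..1} ^^ n) (D 0) has_vector_derivative D (Suc n) z) (at z within {0..1})"
      using z eq by (intro has_vector_derivative_transform[OF z _ D[OF z]]) auto
    then show "(deriv_on {0..1} ^^ n) (D 0) differentiable (at z within {0..1})"
      by (rule differentiableI_vector)
  qed
qed

lemma smooth_on_has_deriv:
  assumes "smooth_on S f" "t \<in> S"
  shows "((deriv_on S ^^ n) f has_vector_derivative (deriv_on S ^^ Suc n) f t) (at t within S)"
  using assms by (simp add: smooth_on_def differentiable_on_def deriv_on_def
      vector_derivative_works[symmetric])


section \<open>The Frechet space of smooth functions on the unit interval\<close>

text \<open>A smooth function on \<open>[0,1]\<close> is represented by its extension by zero to the real line, so
  that equality in the type is equality on \<open>[0,1]\<close>.\<close>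

typedef (overloaded) 'a::real_normed_vector cinf =
  "{f :: real \<Rightarrow> 'a. smooth_on {0..1} f \<and> (\<forall>z. z \<notin> {0..1} \<longrightarrow> f z = 0)}"
  morphisms ev Abs_cinf
proof -
  have "smooth_on {0..1} (\<lambda>_. 0 :: 'a)"
    using smooth_on_family(1)[of "\<lambda>_ _. 0 :: 'a"] by simp
  then show ?thesis by auto
qed

setup_lifting type_definition_cinf

definition cinf :: "(real \<Rightarrow> 'a::real_normed_vector) \<Rightarrow> 'a cinf" where
  "cinf f = Abs_cinf (\<lambda>z. if z \<in> {0..1} then f z else 0)"

lemma smooth_on_add:
  assumes "smooth_on {0..1} f" "smooth_on {0..1} g"
  shows "smooth_on {0..1} (\<lambda>z. f z + g z)"
  using smooth_on_family(1)[of "\<lambda>n z. (deriv_on {0..1} ^^ n) f z + (deriv_on {0..1} ^^ n) g z"]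
    smooth_on_has_deriv[OF assms(1)] smooth_on_has_deriv[OF assms(2)]
  by (simp add: has_vector_derivative_add)

lemma smooth_on_scaleR:
  assumes "smooth_on {0..1} f"
  shows "smooth_on {0..1} (\<lambda>z. c *\<^sub>R f z)"
  using smooth_on_family(1)[of "\<lambda>n z. c *\<^sub>R (deriv_on {0..1} ^^ n) f z"]
    bounded_linear.has_vector_derivative[OF bounded_linear_scaleR_right smooth_on_has_deriv[OF assms]]
  by simp

instantiation cinf :: (real_normed_vector) real_vector
begin

lift_definition zero_cinf :: "'a cinf" is "\<lambda>_. 0"
  using smooth_on_family(1)[of "\<lambda>_ _. 0 :: 'a"] by simp

lift_definition plus_cinf :: "'a cinf \<Rightarrow> 'a cinf \<Rightarrow> 'a cinf" is "\<lambda>f g z. f z + g z"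
  using smooth_on_add by auto

lift_definition scaleR_cinf :: "real \<Rightarrow> 'a cinf \<Rightarrow> 'a cinf" is "\<lambda>c f z. c *\<^sub>R f z"
  using smooth_on_scaleR by auto

lift_definition uminus_cinf :: "'a cinf \<Rightarrow> 'a cinf" is "\<lambda>f z. - f z"
  using smooth_on_scaleR[where c = "-1"] by auto

definition minus_cinf :: "'a cinf \<Rightarrow> 'a cinf \<Rightarrow> 'a cinf" where
  "minus_cinf f g = f + - g"

instance
  by standard (unfold minus_cinf_def, (transfer; simp add: algebra_simps)+)

end

text \<open>Convergence in the Frechet topology: uniform convergence of every derivative.\<close>

definition tendsto_cinf ::
    "('b \<Rightarrow> 'a::real_normed_vector cinf) \<Rightarrow> 'a cinf \<Rightarrow> 'b filter \<Rightarrow> bool" where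
  "tendsto_cinf F f \<F> \<longleftrightarrow>
     (\<forall>n. uniform_limit {0..1} (\<lambda>x. (deriv_on {0..1} ^^ n) (ev (F x)))
        ((deriv_on {0..1} ^^ n) (ev f)) \<F>)"

definition has_cinf_derivative ::
    "(real \<Rightarrow> 'a::real_normed_vector cinf) \<Rightarrow> 'a cinf \<Rightarrow> real \<Rightarrow> bool" where
  "has_cinf_derivative c d t \<longleftrightarrow> tendsto_cinf (\<lambda>s. (c s - c t) /\<^sub>R (s - t)) d (at t)"

definition smooth_curve :: "(real \<Rightarrow> 'a::real_normed_vector cinf) \<Rightarrow> bool" where
  "smooth_curve c \<longleftrightarrow>
     (\<exists>D. D 0 = c \<and> (\<forall>n t. has_cinf_derivative (D n) (D (Suc n) t) t))"


section \<open>The group SE(3) and its Lie algebra\<close>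

text \<open>The index type \<open>3 + 1\<close> is a disjoint sum, which gives the block decomposition.\<close>

type_synonym mat31 = "real^(3 + 1)^(3 + 1)"

text \<open>The matrix with rows \<open>(A u)\<close> and \<open>(0 c)\<close>.\<close>

definition block :: "real^3^3 \<Rightarrow> real^3 \<Rightarrow> real \<Rightarrow> mat31" where
  "block A u c = (\<chi> i j. case i of
       Inl k \<Rightarrow> (case j of Inl l \<Rightarrow> A $ k $ l | Inr _ \<Rightarrow> u $ k)
     | Inr _ \<Rightarrow> (case j of Inl _ \<Rightarrow> 0 | Inr _ \<Rightarrow> c))"

definition SO3 :: "(real^3^3) set" where
  "SO3 = {R. rotation_matrix R}"

definition SE3 :: "mat31 set" where
  "SE3 = {block R u 1 | R u. R \<in> SO3}"

definition jmat :: "real^3 \<Rightarrow> real^3^3" where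
  "jmat \<omega> = matrix (\<lambda>x. cross3 \<omega> x)"

definition omega :: "mat31 \<Rightarrow> real^3" where
  "omega V = (THE \<omega>. \<exists>v. V = block (jmat \<omega>) v 0)"

text \<open>The value \<open>V(x) = \<omega> \<times> x + v\<close> for \<open>V = block (jmat \<omega>) v 0\<close>; the vector \<open>v\<close> is read off
  the last column.\<close>

definition act :: "mat31 \<Rightarrow> real^3 \<Rightarrow> real^3" where
  "act V x = cross3 (omega V) x + (\<chi> k. V $ Inl k $ Inr 1)"

text \<open>Tangent vectors to SE(3), as a submanifold of the matrices, are velocities of smooth curves.\<close>

definition tangent_SE3 :: "mat31 \<Rightarrow> mat31 set" where
  "tangent_SE3 A = {X. \<exists>c. smooth_on UNIV c \<and> (\<forall>t. c t \<in> SE3) \<and> c 0 = A \<and>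
     (c has_vector_derivative X) (at 0)}"


section \<open>The group of smooth maps from the unit interval to SE(3)\<close>

definition G :: "mat31 cinf set" where
  "G = {g. \<forall>z\<in>{0..1}. ev g z \<in> SE3}"

definition neutral :: "mat31 cinf" where
  "neutral = cinf (\<lambda>_. mat 1)"

definition tangent_G :: "mat31 cinf \<Rightarrow> mat31 cinf set" where
  "tangent_G g = {a. \<forall>z\<in>{0..1}. ev a z \<in> tangent_SE3 (ev g z)}"

definition maurer_cartan :: "mat31 cinf \<Rightarrow> mat31 cinf \<Rightarrow> mat31 cinf" where
  "maurer_cartan g a = cinf (\<lambda>z. matrix_inv (ev g z) ** ev a z)"

definition inner_product_on :: "'v::real_vector set \<Rightarrow> ('v \<Rightarrow> 'v \<Rightarrow> real) \<Rightarrow> bool" where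
  "inner_product_on T B \<longleftrightarrow> subspace T \<and>
     (\<forall>a\<in>T. \<forall>b\<in>T. \<forall>c\<in>T. B (a + b) c = B a c + B b c) \<and>
     (\<forall>r. \<forall>a\<in>T. \<forall>b\<in>T. B (r *\<^sub>R a) b = r * B a b) \<and>
     (\<forall>a\<in>T. \<forall>b\<in>T. B a b = B b a) \<and>
     (\<forall>a\<in>T. a \<noteq> 0 \<longrightarrow> 0 < B a a)"

text \<open>Smoothness of the metric is smoothness as a function on the fibre product \<open>TG \<oplus> TG\<close> in the
  sense of Kriegl and Michor: smooth curves are mapped to smooth curves. A curve in
  \<open>TG \<oplus> TG\<close> is a base curve \<open>g\<close> in \<open>G\<close> with two vector fields \<open>a, b\<close> along it; since SE(3) is a
  closed submanifold of the space of matrices, the curve is smooth iff \<open>g, a, b\<close> are smooth curves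
  in the Frechet space of matrix-valued functions. The inner products are not required to induce
  the Frechet topology on the tangent spaces (the metric is weak, which is all one can have on a
  Frechet manifold that is not modelled on a Hilbert space).\<close>

definition riemannian_metric :: "(mat31 cinf \<Rightarrow> mat31 cinf \<Rightarrow> mat31 cinf \<Rightarrow> real) \<Rightarrow> bool" where
  "riemannian_metric B \<longleftrightarrow>
     (\<forall>g\<in>G. inner_product_on (tangent_G g) (B g)) \<and>
     (\<forall>g a b. smooth_curve g \<and> smooth_curve a \<and> smooth_curve b \<and>
        (\<forall>t. g t \<in> G \<and> a t \<in> tangent_G (g t) \<and> b t \<in> tangent_G (g t)) \<longrightarrow>
        smooth_on UNIV (\<lambda>t. B (g t) (a t) (b t)))"


section \<open>Reference configurations, inertia, and the metric\<close>

text \<open>A frame of \<open>\<real>\<^sup>3\<close> at a point is given by the invertible matrix of its column vectors; \<open>SO3\<close> acts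
  on frames by right multiplication.\<close>

definition reference_configuration ::
    "(real \<times> (real^3^3) \<Rightarrow> (real^3) \<times> (real^3^3)) \<Rightarrow> (real^3) cinf \<Rightarrow> bool" where
  "reference_configuration P\<^sub>0 p\<^sub>0 \<longleftrightarrow>
     (\<exists>Q. \<forall>z\<in>{0..1}. \<forall>r\<in>SO3.
        P\<^sub>0 (z, r) = (ev p\<^sub>0 z, Q z r) \<and> invertible (Q z r) \<and>
        (\<forall>q\<in>SO3. P\<^sub>0 (z, q ** r) = (ev p\<^sub>0 z, Q z q ** r)))"

text \<open>Symmetry is part of the notion of an inertia operator; without it the form below would not be
  symmetric.\<close>

definition inertia_operator :: "(real^3 \<Rightarrow> real^3) \<Rightarrow> bool" where
  "inertia_operator J \<longleftrightarrow> linear J \<and> (\<forall>v w. v \<bullet> J w = J v \<bullet> w) \<and> (\<forall>v. v \<noteq> 0 \<longrightarrow> 0 < v \<bullet> J v)"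

definition rod_metric ::
    "(real \<Rightarrow> real) \<Rightarrow> (real \<Rightarrow> real^3 \<Rightarrow> real^3) \<Rightarrow> (real^3) cinf \<Rightarrow>
     mat31 cinf \<Rightarrow> mat31 cinf \<Rightarrow> mat31 cinf \<Rightarrow> real" where
  "rod_metric m J p\<^sub>0 g a b =
     (let A = ev (maurer_cartan g a); B = ev (maurer_cartan g b)
      in LINT z:{0..1}|lebesgue.
           m z * (act (A z) (ev p\<^sub>0 z) \<bullet> act (B z) (ev p\<^sub>0 z))
           + omega (A z) \<bullet> J z (omega (B z)))"

end

theory Submission
  imports Defs
begin

text \<open>The left Maurer-Cartan form sends a tangent vector at the neutral element to itself, which
  gives left invariance.

  Differentiating \<open>R\<^sup>T R = 1\<close> along a curve in SE(3) shows that the Maurer-Cartan form takes values in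
  \<open>se(3)\<close>, and that its angular and linear parts are bilinear in the base point and the tangent
  vector. If a tangent vector \<open>a\<close> has norm zero, then the integrand, which is nonnegative, vanishes
  almost everywhere, and therefore so does \<open>a\<close>; by continuity \<open>a = 0\<close>. Tangent vectors at \<open>A\<close> form a
  subspace because \<open>c A\<^sup>-\<^sup>1 d\<close> is a curve through \<open>A\<close> whose velocity is the sum of those of \<open>c\<close> and \<open>d\<close>.

  For smoothness only the uniform norm is needed. A smooth curve in the Frechet space is a smooth
  curve in the Banach space of bounded continuous functions, pointwise bilinear operations are bounded
  bilinear there, and integration against an integrable weight is a bounded functional. The metric is
  a finite sum of such functionals, applied to polynomial expressions in the given curves.\<close>

section \<open>Closure properties of smooth functions\<close>

text \<open>The predicate \<open>P\<close> plays the role of a class of functions that is closed under differentiation.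
  This spares the Leibniz formula in the proofs of the closure properties below.\<close>

lemma smooth_on_coinduct:
  assumes perfect: "\<forall>z\<in>S. at z within S \<noteq> bot"
    and start: "P f"
    and step: "\<And>u. P u \<Longrightarrow> \<exists>u'. P u' \<and> (\<forall>z\<in>S. (u has_vector_derivative u' z) (at z within S))"
  shows "smooth_on S f"
proof -
  obtain F where F: "\<And>u. P u \<Longrightarrow> P (F u)"
    "\<And>u z. P u \<Longrightarrow> z \<in> S \<Longrightarrow> (u has_vector_derivative F u z) (at z within S)"
    using step by metis
  define D where "D n = (F ^^ n) f" for n
  have P: "P (D n)" for n
    by (induction n) (simp_all add: D_def start F)
  have D: "(D n has_vector_derivative D (Suc n) z) (at z within S)" if "z \<in> S" for n z
    using F(2)[OF P[of n] that] by (simp add: D_def)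
  have eq: "\<forall>z\<in>S. (deriv_on S ^^ n) f z = D n z" for n
  proof (induction n)
    case (Suc n)
    show ?case
    proof
      fix z assume z: "z \<in> S"
      have "((deriv_on S ^^ n) f has_vector_derivative D (Suc n) z) (at z within S)"
        using z Suc by (intro has_vector_derivative_transform[OF z _ D[OF z]]) auto
      then show "(deriv_on S ^^ Suc n) f z = D (Suc n) z"
        using bspec[OF perfect z] by (simp add: deriv_on_def vector_derivative_within)
    qed
  qed (simp add: D_def)
  show ?thesis
    unfolding smooth_on_def differentiable_on_def
  proof (intro allI ballI)
    fix n z assume z: "z \<in> S"
    have "((deriv_on S ^^ n) f has_vector_derivative D (Suc n) z) (at z within S)"
      using z eq by (intro has_vector_derivative_transform[OF z _ D[OF z]]) auto
    then show "(deriv_on S ^^ n) f differentiable (at z within S)"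
      by (rule differentiableI_vector)
  qed
qed

lemma smooth_on_deriv:
  assumes "smooth_on S f"
  shows "smooth_on S (deriv_on S f)"
    and "z \<in> S \<Longrightarrow> (f has_vector_derivative deriv_on S f z) (at z within S)"
  using assms smooth_on_has_deriv[OF assms, of z 0]
  by (simp_all add: smooth_on_def funpow_Suc_right[symmetric] del: funpow.simps)
    (metis funpow_0 funpow_simps_right(2) comp_apply)+

text \<open>The closure lemmas serve both S = [0,1], the rod parameter, and S = UNIV, the time of a
  curve. In both sets every point is a limit point, so derivatives within S are unique.\<close>

context
  fixes S :: "real set"
  assumes perfect: "\<forall>z\<in>S. at z within S \<noteq> bot"
begin

lemma smooth_on_cong:
  fixes f g :: "real \<Rightarrow> 'a::real_normed_vector"
  assumes "smooth_on S f" "\<And>z. z \<in> S \<Longrightarrow> f z = g z"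
  shows "smooth_on S g"
proof (rule smooth_on_coinduct[where P = "\<lambda>u. \<exists>f. smooth_on S f \<and> (\<forall>z\<in>S. f z = u z)", OF perfect])
  fix u :: "real \<Rightarrow> 'a" assume "\<exists>f. smooth_on S f \<and> (\<forall>z\<in>S. f z = u z)"
  then obtain f where f: "smooth_on S f" "\<forall>z\<in>S. f z = u z" by blast
  have "(u has_vector_derivative deriv_on S f z) (at z within S)" if "z \<in> S" for z
    using f that by (intro has_vector_derivative_transform[OF that _ smooth_on_deriv(2)[OF f(1) that]]) auto
  then show "\<exists>u'. (\<exists>f. smooth_on S f \<and> (\<forall>z\<in>S. f z = u' z)) \<and>
      (\<forall>z\<in>S. (u has_vector_derivative u' z) (at z within S))"
    using smooth_on_deriv(1)[OF f(1)] by blast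
qed (use assms in auto)

text \<open>Finite sums of terms \<open>h (f i t) (g i t)\<close> with smooth \<open>f i\<close> and
  \<open>g i\<close> form a class closed under differentiation: the product rule turns n terms into
  2n terms of the same kind.\<close>

lemma smooth_on_bounded_bilinear:
  assumes h: "bounded_bilinear h" and f: "smooth_on S f" and g: "smooth_on S g"
  shows "smooth_on S (\<lambda>t. h (f t) (g t))"
proof -
  interpret bounded_bilinear h by (rule h)
  define P where "P u \<longleftrightarrow> (\<exists>(n::nat) f g. (\<forall>i<n. smooth_on S (f i) \<and> smooth_on S (g i)) \<and>
      u = (\<lambda>t. \<Sum>i<n. h (f i t) (g i t)))" for u
  show ?thesis
  proof (rule smooth_on_coinduct[where P = P, OF perfect])
    show "P (\<lambda>t. h (f t) (g t))"
      unfolding P_def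
      by (rule exI[of _ 1], rule exI[of _ "\<lambda>_. f"], rule exI[of _ "\<lambda>_. g"]) (use f g in simp)
  next
    fix u assume "P u"
    then obtain n :: nat and f g where s: "\<And>i. i < n \<Longrightarrow> smooth_on S (f i)" "\<And>i. i < n \<Longrightarrow> smooth_on S (g i)"
      and u: "u = (\<lambda>t. \<Sum>i<n. h (f i t) (g i t))"
      unfolding P_def by blast
    \<comment> \<open>Indices below n carry the terms in which \<open>g i\<close> is differentiated,
      those from n to 2n - 1 the terms in which \<open>f i\<close> is.\<close>
    define f' where "f' i = (if i < n then f i else deriv_on S (f (i - n)))" for i
    define g' where "g' i = (if i < n then deriv_on S (g i) else g (i - n))" for i
    define u' where "u' = (\<lambda>t. \<Sum>i<n+n. h (f' i t) (g' i t))"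
    have "P u'"
      unfolding P_def u'_def
      by (rule exI[of _ "n+n"], rule exI[of _ f'], rule exI[of _ g'])
        (auto simp: f'_def g'_def s smooth_on_deriv(1))
    moreover have "(u has_vector_derivative u' z) (at z within S)" if z: "z \<in> S" for z
    proof -
      have "(u has_vector_derivative (\<Sum>i<n. h (f i z) (deriv_on S (g i) z) + h (deriv_on S (f i) z) (g i z)))
        (at z within S)"
        unfolding u
        by (intro has_vector_derivative_sum has_vector_derivative smooth_on_deriv(2) s z) auto
      also have "(\<Sum>i<n. h (f i z) (deriv_on S (g i) z) + h (deriv_on S (f i) z) (g i z)) = u' z"
        by (simp add: u'_def sum.distrib f'_def g'_def lessThan_atLeast0 sum.atLeastLessThan_concat[of 0 n "n+n", symmetric]
          sum.shift_bounds_nat_ivl[of _ 0 n n, simplified])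
      finally show ?thesis .
    qed
    ultimately show "\<exists>u'. P u' \<and> (\<forall>z\<in>S. (u has_vector_derivative u' z) (at z within S))"
      by blast
  qed
qed

lemma smooth_on_plus:
  assumes "smooth_on S f" "smooth_on S g"
  shows "smooth_on S (\<lambda>t. f t + g t :: 'a::real_normed_vector)"
proof (rule smooth_on_coinduct[where P = "\<lambda>u. \<exists>f g. smooth_on S f \<and> smooth_on S g \<and> u = (\<lambda>t. f t + g t)", OF perfect])
  fix u :: "real \<Rightarrow> 'a" assume "\<exists>f g. smooth_on S f \<and> smooth_on S g \<and> u = (\<lambda>t. f t + g t)"
  then obtain f g where fg: "smooth_on S f" "smooth_on S g" and u: "u = (\<lambda>t. f t + g t)" by blast
  have "\<forall>z\<in>S. (u has_vector_derivative deriv_on S f z + deriv_on S g z) (at z within S)"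
    unfolding u by (intro ballI has_vector_derivative_add smooth_on_deriv(2) fg)
  then show "\<exists>u'. (\<exists>f g. smooth_on S f \<and> smooth_on S g \<and> u' = (\<lambda>t. f t + g t)) \<and>
      (\<forall>z\<in>S. (u has_vector_derivative u' z) (at z within S))"
    using smooth_on_deriv(1)[OF fg(1)] smooth_on_deriv(1)[OF fg(2)] by blast
qed (use assms in auto)

lemma smooth_on_bounded_linear:
  assumes h: "bounded_linear h" and f: "smooth_on S f"
  shows "smooth_on S (\<lambda>t. h (f t))"
proof (rule smooth_on_coinduct[where P = "\<lambda>u. \<exists>f. smooth_on S f \<and> u = (\<lambda>t. h (f t))", OF perfect])
  fix u assume "\<exists>f. smooth_on S f \<and> u = (\<lambda>t. h (f t))"
  then obtain f where f: "smooth_on S f" and u: "u = (\<lambda>t. h (f t))" by blast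
  have "\<forall>z\<in>S. (u has_vector_derivative h (deriv_on S f z)) (at z within S)"
    unfolding u by (intro ballI bounded_linear.has_vector_derivative[OF h] smooth_on_deriv(2) f)
  then show "\<exists>u'. (\<exists>f. smooth_on S f \<and> u' = (\<lambda>t. h (f t))) \<and>
      (\<forall>z\<in>S. (u has_vector_derivative u' z) (at z within S))"
    using smooth_on_deriv(1)[OF f] by blast
qed (use assms in auto)

lemma smooth_on_const: "smooth_on S (\<lambda>_. c)"
  by (rule smooth_on_coinduct[where P = "\<lambda>u. \<exists>c. u = (\<lambda>_. c)", OF perfect]) (auto intro!: exI[of _ "\<lambda>_. 0"])

lemma smooth_on_sum:
  assumes "\<And>i. i \<in> I \<Longrightarrow> smooth_on S (f i)"
  shows "smooth_on S (\<lambda>t. \<Sum>i\<in>I. f i t)"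
  using assms by (induction I rule: infinite_finite_induct) (simp_all add: smooth_on_const smooth_on_plus)

end


section \<open>Tangent vectors to SE(3)\<close>

definition rot_part :: "mat31 \<Rightarrow> real^3^3" where
  "rot_part X = (\<chi> i j. X $ Inl i $ Inl j)"

definition trans_part :: "mat31 \<Rightarrow> real^3" where
  "trans_part X = (\<chi> k. X $ Inl k $ Inr 1)"

text \<open>A left inverse of \<open>jmat\<close> given by a linear formula; in computations it
  replaces the definite description in \<open>omega\<close>.\<close>

definition axial :: "real^3^3 \<Rightarrow> real^3" where
  "axial S = vector [S $ 3 $ 2, S $ 1 $ 3, S $ 2 $ 1]"

lemma rot_part_block [simp]: "rot_part (block A u c) = A"
  by (simp add: rot_part_def block_def vec_eq_iff)

lemma trans_part_block [simp]: "trans_part (block A u c) = u"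
  by (simp add: trans_part_def block_def vec_eq_iff)

lemma block_inject: "block A u c = block B v d \<longleftrightarrow> A = B \<and> u = v \<and> c = d"
proof
  assume *: "block A u c = block B v d"
  have "block A u c $ Inr 1 $ Inr 1 = block B v d $ Inr 1 $ Inr 1" by (simp add: *)
  then show "A = B \<and> u = v \<and> c = d"
    using arg_cong[OF *, of rot_part] arg_cong[OF *, of trans_part]
    by (simp only: rot_part_block trans_part_block) (simp add: block_def)
qed simp

lemma block_parts:
  assumes "\<And>j. X $ Inr 1 $ j = (case j of Inl _ \<Rightarrow> 0 | Inr _ \<Rightarrow> c)"
  shows "X = block (rot_part X) (trans_part X) c"
  using assms
  by (auto simp: vec_eq_iff block_def rot_part_def trans_part_def num1_eq1 split: sum.split)

lemma sum_UNIV_3_plus_1: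
  "(\<Sum>k\<in>UNIV. f k) = (\<Sum>k\<in>UNIV. f (Inl k :: 3 + 1)) + f (Inr 1)"
  by (simp add: UNIV_Plus_UNIV[symmetric] sum.Plus UNIV_1)

text \<open>The corner entries stay general so that one formula covers products in the group (c = d
  = 1) and the product of a group element with a tangent vector (c = 1, d = 0).\<close>

lemma block_mult:
  "block A u c ** block B v d = block (A ** B) (A *v v + d *\<^sub>R u) (c * d)"
  by (auto simp: vec_eq_iff block_def matrix_matrix_mult_def matrix_vector_mult_def sum_UNIV_3_plus_1
      mult.commute split: sum.split)

lemma block_mat_1: "block (mat 1) 0 1 = mat 1"
  by (auto simp: vec_eq_iff block_def mat_def num1_eq1 split: sum.split)

text \<open>\<open>matrix_inv\<close> is a Hilbert choice. The witness \<open>B\<close> makes the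
  chosen matrix a two-sided inverse, and such an inverse is unique.\<close>

lemma matrix_inv_eqI:
  fixes A B :: "real^'n^'n"
  assumes "A ** B = mat 1" "B ** A = mat 1"
  shows "matrix_inv A = B"
proof -
  have "A ** matrix_inv A = mat 1 \<and> matrix_inv A ** A = mat 1"
    unfolding matrix_inv_def by (rule someI[where x = B]) (simp add: assms)
  then show ?thesis
    using assms by (metis matrix_mul_assoc matrix_mul_lid matrix_mul_rid)
qed

lemma SO3_orthogonal:
  assumes "R \<in> SO3"
  shows "transpose R ** R = mat 1" "R ** transpose R = mat 1"
  using assms by (simp_all add: SO3_def rotation_matrix_def orthogonal_matrix_def)

lemma SO3_mult: "R \<in> SO3 \<Longrightarrow> Q \<in> SO3 \<Longrightarrow> R ** Q \<in> SO3"
  by (simp add: SO3_def rotation_matrix_def orthogonal_matrix_mul det_mul)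

lemma SO3_transpose: "R \<in> SO3 \<Longrightarrow> transpose R \<in> SO3"
  by (simp add: SO3_def rotation_matrix_def)

lemma SE3_cases:
  assumes "A \<in> SE3"
  obtains "rot_part A \<in> SO3" "A = block (rot_part A) (trans_part A) 1"
  using assms by (auto simp: SE3_def)

lemma SE3_mult: "A \<in> SE3 \<Longrightarrow> B \<in> SE3 \<Longrightarrow> A ** B \<in> SE3"
  by (force simp: SE3_def block_mult intro: SO3_mult)

lemma SE3_inverse:
  assumes "A \<in> SE3"
  shows "matrix_inv A = block (transpose (rot_part A)) (- (transpose (rot_part A) *v trans_part A)) 1"
    and "matrix_inv A \<in> SE3" and "A ** matrix_inv A = mat 1" and "matrix_inv A ** A = mat 1"
proof -
  let ?R = "rot_part A" and ?u = "trans_part A"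
  let ?B = "block (transpose ?R) (- (transpose ?R *v ?u)) 1"
  obtain R: "?R \<in> SO3" and A: "A = block ?R ?u 1"
    using assms by (rule SE3_cases)
  \<comment> \<open>The equation \<open>A\<close> has the variable on both sides, so rewriting with
    it from left to right would loop. The block form is multiplied first and folded back
    afterwards.\<close>
  have "block ?R ?u 1 ** ?B = mat 1" "?B ** block ?R ?u 1 = mat 1"
    using SO3_orthogonal[OF R]
    by (simp_all add: block_mult matrix_vector_mul_assoc block_mat_1
      linear_neg[OF matrix_vector_mul_linear] del: transpose_matrix_vector)
  then have AB: "A ** ?B = mat 1" "?B ** A = mat 1"
    by (simp_all flip: A)
  show *: "matrix_inv A = ?B" by (rule matrix_inv_eqI[OF AB])
  show "matrix_inv A \<in> SE3"
    using SO3_transpose[OF R] unfolding * SE3_def by blast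
  show "A ** matrix_inv A = mat 1" "matrix_inv A ** A = mat 1"
    using AB by (simp_all add: *)
qed

section \<open>Skew-symmetric matrices and their axial vectors\<close>

lemma jmat_eq:
  "jmat w = vector [vector [0, - w $ 3, w $ 2], vector [w $ 3, 0, - w $ 1], vector [- w $ 2, w $ 1, 0]]"
  by (simp add: vec_eq_iff forall_3 jmat_def matrix_def cross3_def axis_def)

text \<open>A skew-symmetric matrix has zero diagonal and is determined by three off-diagonal
  entries, one from each pair; \<open>axial\<close> collects them.\<close>

lemma jmat_axial:
  assumes "transpose S = - S"
  shows "S = jmat (axial S)"
proof -
  have "S $ j $ i = - S $ i $ j" for i j
    using arg_cong[OF assms, of "\<lambda>M. M $ i $ j"] by (simp add: transpose_def)
  from this[of 1 1] this[of 2 2] this[of 3 3] this[of 1 2] this[of 1 3] this[of 2 3]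
  have "S $ 1 $ 1 = 0" "S $ 2 $ 2 = 0" "S $ 3 $ 3 = 0" "S $ 2 $ 1 = - S $ 1 $ 2"
    "S $ 3 $ 1 = - S $ 1 $ 3" "S $ 3 $ 2 = - S $ 2 $ 3"
    by linarith+
  then show ?thesis
    by (simp add: vec_eq_iff forall_3 jmat_eq axial_def)
qed

lemma axial_jmat: "axial (jmat w) = w"
  by (simp add: vec_eq_iff[where 'a = real] forall_3 jmat_eq axial_def)

text \<open>\<open>jmat_axial\<close> provides existence and \<open>axial_jmat\<close> uniqueness
  for the definite description.\<close>

lemma omega_block:
  assumes "transpose S = - S"
  shows "omega (block S v 0) = axial S"
  unfolding omega_def
  by (rule the_equality) (use jmat_axial[OF assms] axial_jmat in \<open>auto simp: block_inject\<close>)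

lemma act_block:
  assumes "transpose S = - S"
  shows "act (block S v 0) x = cross3 (axial S) x + v"
  using trans_part_block[of S v 0] by (simp add: act_def omega_block[OF assms] trans_part_def)

section \<open>Body velocities as bounded bilinear maps\<close>

lemma bounded_linear_rot_part: "bounded_linear rot_part"
  by (simp add: linear_conv_bounded_linear[symmetric] linear_iff rot_part_def vec_eq_iff)

lemma bounded_linear_axial: "bounded_linear axial"
  by (simp add: linear_conv_bounded_linear[symmetric] linear_iff axial_def vec_eq_iff forall_3)

lemma bounded_bilinear_matrix_mult: "bounded_bilinear ((**) :: real^'n^'m \<Rightarrow> real^'k^'n \<Rightarrow> _)"
  by (simp add: bilinear_conv_bounded_bilinear[symmetric] bilinear_def linear_iff vec_eq_iff
      matrix_matrix_mult_def algebra_simps sum.distrib sum_distrib_left)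

lemma bounded_linear_transpose: "bounded_linear (transpose :: real^'n^'m \<Rightarrow> _)"
  by (simp add: linear_conv_bounded_linear[symmetric] linear_iff transpose_def vec_eq_iff)

text \<open>Although the inverse of \<open>A\<close> is quadratic in \<open>A\<close>, the two nonzero blocks of the product of this
  inverse with a tangent vector \<open>X\<close> are bilinear in \<open>A\<close> and \<open>X\<close>.\<close>

definition rel_rot :: "mat31 \<Rightarrow> mat31 \<Rightarrow> real^3^3" where
  "rel_rot A X = transpose (rot_part A) ** rot_part X"

definition body_velocity :: "mat31 \<Rightarrow> mat31 \<Rightarrow> real^3" where
  "body_velocity A X = transpose (rot_part A) *v trans_part X"

text \<open>For \<open>X\<close> tangent at \<open>A\<close> this is the angular velocity in the
  body frame. Defined through \<open>axial\<close>, it is bilinear on all pairs of matrices and not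
  just on tangent pairs.\<close>

definition body_rotation :: "mat31 \<Rightarrow> mat31 \<Rightarrow> real^3" where
  "body_rotation A X = axial (rel_rot A X)"

lemma bounded_bilinear_rel_rot: "bounded_bilinear rel_rot"
  unfolding rel_rot_def
  by (rule bounded_bilinear.comp[OF bounded_bilinear_matrix_mult
     bounded_linear_compose[OF bounded_linear_transpose bounded_linear_rot_part] bounded_linear_rot_part])

lemma bounded_bilinear_body_velocity: "bounded_bilinear body_velocity"
  by (simp add: bilinear_conv_bounded_bilinear[symmetric] bilinear_def linear_iff vec_eq_iff
      body_velocity_def rot_part_def trans_part_def transpose_def matrix_vector_mult_def
      algebra_simps sum.distrib sum_distrib_left)

lemma bounded_bilinear_body_rotation: "bounded_bilinear body_rotation"
proof -
  have "linear (axial \<circ> f)" if "linear f" for f :: "mat31 \<Rightarrow> _"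
    using that bounded_linear.linear[OF bounded_linear_axial] by (rule linear_compose)
  then show ?thesis
    using bounded_bilinear_rel_rot
    unfolding bilinear_conv_bounded_bilinear[symmetric] bilinear_def body_rotation_def o_def by blast
qed

text \<open>The bottom row is constant along a curve in SE(3), so it vanishes in the velocity. Along
  the curve \<open>rel_rot (c t) (c t)\<close> is R^T R = 1, and its derivative is
  \<open>rel_rot A X\<close> plus its transpose.\<close>

lemma tangent_SE3_parts:
  assumes A: "A \<in> SE3" and X: "X \<in> tangent_SE3 A"
  shows "X = block (rot_part X) (trans_part X) 0"
    and "transpose (rel_rot A X) = - rel_rot A X"
proof -
  obtain c where c: "\<And>t. c t \<in> SE3" "c 0 = A" and dc: "(c has_vector_derivative X) (at 0)"
    using X by (auto simp: tangent_SE3_def)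
  have "X $ Inr 1 $ j = 0" for j
  proof -
    have "bounded_linear (\<lambda>X::mat31. X $ Inr 1 $ j)"
      by (simp add: linear_conv_bounded_linear[symmetric] linear_iff)
    from bounded_linear.has_vector_derivative[OF this dc]
    have "((\<lambda>t. c t $ Inr 1 $ j) has_vector_derivative X $ Inr 1 $ j) (at 0)" .
    moreover have "c t $ Inr 1 $ j = c 0 $ Inr 1 $ j" for t
      using c(1)[of t] c(1)[of 0] by (auto simp: SE3_def block_def)
    then have "((\<lambda>t. c t $ Inr 1 $ j) has_vector_derivative 0) (at 0)"
      by (metis (mono_tags, lifting) has_vector_derivative_const has_vector_derivative_transform UNIV_I)
    ultimately show ?thesis
      by (rule vector_derivative_unique_at)
  qed
  then show "X = block (rot_part X) (trans_part X) 0"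
    by (intro block_parts) (simp split: sum.split)
  have "((\<lambda>t. rel_rot (c t) (c t)) has_vector_derivative rel_rot (c 0) X + rel_rot X (c 0)) (at 0)"
    by (rule bounded_bilinear.has_vector_derivative[OF bounded_bilinear_rel_rot dc dc])
  moreover have "rel_rot (c t) (c t) = mat 1" for t
    using c(1)[of t] by (elim SE3_cases) (simp add: rel_rot_def SO3_orthogonal)
  ultimately have "((\<lambda>t. mat 1) has_vector_derivative rel_rot A X + rel_rot X A) (at 0)"
    by (simp add: c)
  then have "rel_rot A X + rel_rot X A = 0"
    using has_vector_derivative_const vector_derivative_unique_at by blast
  moreover have "rel_rot X A = transpose (rel_rot A X)"
    by (simp add: rel_rot_def matrix_transpose_mul)
  ultimately show "transpose (rel_rot A X) = - rel_rot A X"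
    by (simp add: add_eq_0_iff)
qed

text \<open>The translation part of the inverse, which is quadratic in \<open>A\<close>, is
  multiplied by the corner entry 0 of \<open>X\<close> and drops out.\<close>

lemma matrix_inv_tangent:
  assumes A: "A \<in> SE3" and X: "X \<in> tangent_SE3 A"
  shows "matrix_inv A ** X = block (rel_rot A X) (body_velocity A X) 0"
  by (subst tangent_SE3_parts(1)[OF A X])
    (simp add: SE3_inverse(1)[OF A] block_mult rel_rot_def body_velocity_def
      del: transpose_matrix_vector)

lemma omega_body:
  assumes "A \<in> SE3" "X \<in> tangent_SE3 A"
  shows "omega (matrix_inv A ** X) = body_rotation A X"
  by (simp add: matrix_inv_tangent omega_block tangent_SE3_parts(2) body_rotation_def assms)

lemma act_body:
  assumes "A \<in> SE3" "X \<in> tangent_SE3 A"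
  shows "act (matrix_inv A ** X) p = cross3 (body_rotation A X) p + body_velocity A X"
  by (simp add: matrix_inv_tangent act_block tangent_SE3_parts(2) body_rotation_def assms)

text \<open>The two velocities determine both blocks of \<open>matrix_inv A ** X\<close>, so this
  product vanishes; multiplying by \<open>A\<close> recovers \<open>X\<close>.\<close>

lemma tangent_SE3_eq_0:
  assumes A: "A \<in> SE3" and X: "X \<in> tangent_SE3 A"
    and 0: "body_rotation A X = 0" "body_velocity A X = 0"
  shows "X = 0"
proof -
  have "rel_rot A X = jmat 0"
    using jmat_axial[OF tangent_SE3_parts(2)[OF A X]] 0(1) by (simp add: body_rotation_def)
  then have "matrix_inv A ** X = 0"
    by (simp add: matrix_inv_tangent[OF A X] 0(2) vec_eq_iff block_def jmat_eq forall_3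
      split: sum.split)
  moreover have "X = A ** (matrix_inv A ** X)"
    by (simp add: matrix_mul_assoc SE3_inverse(3)[OF A])
  ultimately show ?thesis by simp
qed

text \<open>Each vector is realised by an explicit curve defined for all times: a constant curve for
  zero, a product in the group for a sum, and the curve run at speed r for a multiple.\<close>

lemma subspace_tangent_SE3:
  assumes A: "A \<in> SE3"
  shows "subspace (tangent_SE3 A)"
proof (rule subspaceI)
  show "0 \<in> tangent_SE3 A"
    unfolding tangent_SE3_def
    using A by (auto intro!: exI[of _ "\<lambda>_. A"] smooth_on_const)
next
  fix X Y assume "X \<in> tangent_SE3 A" "Y \<in> tangent_SE3 A"
  then obtain c d where c: "smooth_on UNIV c" "\<And>t. c t \<in> SE3" "c 0 = A" "(c has_vector_derivative X) (at 0)"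
    and d: "smooth_on UNIV d" "\<And>t. d t \<in> SE3" "d 0 = A" "(d has_vector_derivative Y) (at 0)"
    by (auto simp: tangent_SE3_def)
  let ?e = "\<lambda>t. c t ** (matrix_inv A ** d t)"
  have L: "bounded_linear (\<lambda>X. matrix_inv A ** X)"
    by (rule bounded_bilinear.bounded_linear_right[OF bounded_bilinear_matrix_mult])
  have "smooth_on UNIV ?e"
    by (intro smooth_on_bounded_bilinear[OF _ bounded_bilinear_matrix_mult] smooth_on_bounded_linear[OF _ L] c d) auto
  moreover have "?e t \<in> SE3" for t
    by (intro SE3_mult SE3_inverse(2) c d A)
  moreover have "?e 0 = A"
    by (simp add: c d SE3_inverse(4)[OF A])
  \<comment> \<open>At time 0 both curves are at \<open>A\<close>, so the factor
    \<open>matrix_inv A\<close> cancels in each summand of the product rule.\<close>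
  moreover have "(?e has_vector_derivative c 0 ** (matrix_inv A ** Y) + X ** (matrix_inv A ** d 0)) (at 0)"
    by (rule bounded_bilinear.has_vector_derivative[OF bounded_bilinear_matrix_mult c(4)
         bounded_linear.has_vector_derivative[OF L d(4)]])
  then have "(?e has_vector_derivative X + Y) (at 0)"
    by (simp add: c d SE3_inverse(3,4)[OF A] matrix_mul_assoc add.commute)
  ultimately show "X + Y \<in> tangent_SE3 A"
    unfolding tangent_SE3_def by blast
next
  fix X and r :: real assume "X \<in> tangent_SE3 A"
  then obtain c where c: "smooth_on UNIV c" "\<And>t. c t \<in> SE3" "c 0 = A" "(c has_vector_derivative X) (at 0)"
    by (auto simp: tangent_SE3_def)
  have chain: "((\<lambda>t. u (r * t)) has_vector_derivative r *\<^sub>R v) (at t)"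
    if "(u has_vector_derivative v) (at (r * t))" for u :: "real \<Rightarrow> mat31" and v t
    using vector_diff_chain_at[of "\<lambda>t. r * t" r t u v] that
    by (auto simp: o_def has_real_derivative_iff_has_vector_derivative[symmetric] intro!: derivative_eq_intros)
  have "smooth_on UNIV (\<lambda>t. c (r * t))"
  \<comment> \<open>The class carries a factor b because each differentiation of
    \<open>c (r * t)\<close> produces a further factor r.\<close>
  proof (rule smooth_on_coinduct[where P = "\<lambda>u. \<exists>b c. smooth_on UNIV c \<and> u = (\<lambda>t. b *\<^sub>R c (r * t))"])
    show "\<exists>b ca. smooth_on UNIV ca \<and> (\<lambda>t. c (r * t)) = (\<lambda>t. b *\<^sub>R ca (r * t))"
      using c(1) by (intro exI[of _ 1] exI[of _ c]) simp
    fix u :: "real \<Rightarrow> mat31" assume "\<exists>b c. smooth_on UNIV c \<and> u = (\<lambda>t. b *\<^sub>R c (r * t))"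
    then obtain b c where c: "smooth_on UNIV c" and u: "u = (\<lambda>t. b *\<^sub>R c (r * t))" by blast
    have "(u has_vector_derivative b *\<^sub>R r *\<^sub>R deriv_on UNIV c (r * t)) (at t)" for t
      unfolding u using smooth_on_deriv(2)[OF c]
      by (intro bounded_linear.has_vector_derivative[OF bounded_linear_scaleR_right] chain) auto
    then show "\<exists>u'. (\<exists>b c. smooth_on UNIV c \<and> u' = (\<lambda>t. b *\<^sub>R c (r * t))) \<and>
        (\<forall>z\<in>UNIV. (u has_vector_derivative u' z) (at z))"
      using smooth_on_deriv(1)[OF c]
      by (intro exI[of _ "\<lambda>t. (b * r) *\<^sub>R deriv_on UNIV c (r * t)"]) (auto simp: scaleR_scaleR)
  qed simp
  then show "r *\<^sub>R X \<in> tangent_SE3 A"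
    unfolding tangent_SE3_def using c chain[of c X 0]
    by (auto intro!: exI[of _ "\<lambda>t. c (r * t)"])
qed


section \<open>Smooth functions on the unit interval as bounded continuous functions\<close>

lemma perfect_unit_interval: "\<forall>z\<in>{0..1::real}. at z within {0..1} \<noteq> bot"
  by (simp add: trivial_limit_within islimpt_Icc)

lemma smooth_on_imp_continuous_on: "smooth_on S f \<Longrightarrow> continuous_on S f"
  unfolding continuous_on_eq_continuous_within
  by (intro ballI has_vector_derivative_continuous[OF smooth_on_deriv(2)])

lemma ev_smooth_on: "smooth_on {0..1} (ev f)"
  using ev[of f] by simp

lemma ev_outside: "z \<notin> {0..1} \<Longrightarrow> ev f z = 0"
  using ev[of f] by blast

lemma continuous_on_ev: "continuous_on {0..1} (ev f)"
  by (intro smooth_on_imp_continuous_on ev_smooth_on)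

lemma cinf_eqI:
  assumes "\<And>z. z \<in> {0..1} \<Longrightarrow> ev f z = ev g z"
  shows "f = g"
proof -
  have "ev f z = ev g z" for z
    using assms[of z] ev_outside[of z f] ev_outside[of z g] by argo
  then show ?thesis
    by (intro iffD1[OF ev_inject] ext)
qed

lemma ev_cinf:
  assumes "smooth_on {0..1} f" "z \<in> {0..1}"
  shows "ev (cinf f) z = f z"
proof -
  have "smooth_on {0..1} (\<lambda>z. if z \<in> {0..1} then f z else 0)"
    by (rule smooth_on_cong[OF perfect_unit_interval assms(1)]) simp_all
  then show ?thesis
    using assms(2) by (simp add: cinf_def Abs_cinf_inverse)
qed

lemmas ev_simps = zero_cinf.rep_eq plus_cinf.rep_eq scaleR_cinf.rep_eq uminus_cinf.rep_eq

lemma ev_diff: "ev (f - g) z = ev f z - ev g z"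
  unfolding minus_cinf_def ev_simps by simp

text \<open>Bounded continuous functions live on all of \<open>\<real>\<close>, so \<open>f\<close> is continued constantly beyond the
  endpoints. Its extension by zero is in general discontinuous there.\<close>

definition bcf :: "'a::real_normed_vector cinf \<Rightarrow> real \<Rightarrow>\<^sub>C 'a" where
  "bcf f = Bcontfun (\<lambda>z. ev f (clamp 0 1 z))"

lemma clamp_unit: "clamp 0 1 z \<in> {0..1::real}"
  using clamp_in_interval[of "0::real" 1 z] by simp

text \<open>\<open>Bcontfun\<close> is meaningful only on bounded continuous functions; continuity
  on the compact interval makes the clamped function one of these.\<close>

lemma apply_bcf: "apply_bcontfun (bcf f) z = ev f (clamp 0 1 z)"
proof -
  obtain g :: "real \<Rightarrow>\<^sub>C 'a" where g: "\<And>z. apply_bcontfun g z = ev f (clamp 0 1 z)"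
    using continuous_on_cbox_bcontfunE[of 0 1 "ev f"] continuous_on_ev[of f] by auto
  then have "bcf f = Bcontfun (apply_bcontfun g)"
    unfolding bcf_def by presburger
  then show ?thesis
    by (simp add: apply_bcontfun_inverse g)
qed

lemma bcf_diff_quotient: "bcf ((f - g) /\<^sub>R r) = (bcf f - bcf g) /\<^sub>R r"
  by (rule bcontfun_eqI) (simp add: apply_bcf ev_simps ev_diff)

text \<open>The case n = 0 of convergence in the Frechet space is uniform convergence of the
  difference quotients on [0,1], which is norm convergence of their images under
  \<open>bcf\<close>.\<close>

lemma has_cinf_derivative_bcf:
  assumes "has_cinf_derivative c d t"
  shows "((\<lambda>s. bcf (c s)) has_vector_derivative bcf d) (at t)"
proof -
  have "uniform_limit {0..1} (\<lambda>s. ev ((c s - c t) /\<^sub>R (s - t))) (ev d) (at t)"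
    using spec[OF assms[unfolded has_cinf_derivative_def tendsto_cinf_def], of 0]
    by simp
  then have "uniform_limit UNIV (\<lambda>s z. ev ((c s - c t) /\<^sub>R (s - t)) (clamp 0 1 z))
      (\<lambda>z. ev d (clamp 0 1 z)) (at t)"
    unfolding uniform_limit_iff by (rule all_forward) (auto elim!: eventually_mono intro: clamp_unit)
  then have "((\<lambda>s. bcf ((c s - c t) /\<^sub>R (s - t))) \<longlongrightarrow> bcf d) (at t)"
    by (intro uniform_limit_tendsto_bcontfun) (simp add: apply_bcf[abs_def])
  then have "((\<lambda>s. (bcf (c s) - bcf (c t)) /\<^sub>R (s - t)) \<longlongrightarrow> bcf d) (at t)"
    by (simp add: bcf_diff_quotient)
  then have "((\<lambda>s. norm ((bcf (c s) - bcf (c t)) /\<^sub>R (s - t) - bcf d)) \<longlongrightarrow> 0) (at t)"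
    by (simp add: tendsto_norm_zero_iff LIM_zero_iff)
  \<comment> \<open>The two norms agree only for s \<noteq> t, where s - t can be divided out; this
    suffices for a limit at t.\<close>
  then have "((\<lambda>s. norm (bcf (c s) - bcf (c t) - (s - t) *\<^sub>R bcf d) / norm (s - t)) \<longlongrightarrow> 0) (at t)"
  proof (rule Lim_transform_eventually)
    have "norm ((x :: real \<Rightarrow>\<^sub>C 'a) /\<^sub>R (s - t) - y) = norm (x - (s - t) *\<^sub>R y) / norm (s - t)"
      if "s \<noteq> t" for s x y
    proof -
      have "x /\<^sub>R (s - t) - y = (x - (s - t) *\<^sub>R y) /\<^sub>R (s - t)"
        using that by (simp add: scaleR_diff_right)
      then show ?thesis
        by (simp add: divide_inverse mult.commute)
    qed
    then show "\<forall>\<^sub>F s in at t. norm ((bcf (c s) - bcf (c t)) /\<^sub>R (s - t) - bcf d) =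
        norm (bcf (c s) - bcf (c t) - (s - t) *\<^sub>R bcf d) / norm (s - t)"
      by (auto simp: eventually_at_filter)
  qed
  then show ?thesis
    unfolding has_vector_derivative_def has_derivative_iff_norm
    by (simp add: bounded_linear_scaleR_left)
qed

text \<open>Shifting the family \<open>D\<close> by one index shows that the derivative of a smooth
  curve is a smooth curve, so the images under \<open>bcf\<close> form a class closed under
  differentiation.\<close>

lemma smooth_curve_bcf:
  assumes "smooth_curve c"
  shows "smooth_on UNIV (\<lambda>t. bcf (c t))"
proof (rule smooth_on_coinduct[where P = "\<lambda>u. \<exists>c. smooth_curve c \<and> u = (\<lambda>t. bcf (c t))"])
  fix u :: "real \<Rightarrow> real \<Rightarrow>\<^sub>C 'a" assume "\<exists>c. smooth_curve c \<and> u = (\<lambda>t. bcf (c t))"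
  then obtain c D where u: "u = (\<lambda>t. bcf (c t))" and D: "D 0 = c"
    "\<And>n t. has_cinf_derivative (D n) (D (Suc n) t) t"
    by (auto simp: smooth_curve_def)
  have "smooth_curve (D 1)"
    unfolding smooth_curve_def using D(2) by (intro exI[of _ "\<lambda>n. D (Suc n)"]) auto
  moreover have "(u has_vector_derivative bcf (D 1 t)) (at t)" for t
    using has_cinf_derivative_bcf[OF D(2)[of 0 t]] by (simp add: u D(1))
  ultimately show "\<exists>u'. (\<exists>c. smooth_curve c \<and> u' = (\<lambda>t. bcf (c t))) \<and>
      (\<forall>z\<in>UNIV. (u has_vector_derivative u' z) (at z))"
    by blast
qed (use assms in auto)

section \<open>Pointwise bilinear operations on bounded continuous functions\<close>

definition pointwise :: "('a::real_normed_vector \<Rightarrow> 'b::real_normed_vector \<Rightarrow> 'c::real_normed_vector) \<Rightarrow>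
    (real \<Rightarrow>\<^sub>C 'a) \<Rightarrow> (real \<Rightarrow>\<^sub>C 'b) \<Rightarrow> (real \<Rightarrow>\<^sub>C 'c)" where
  "pointwise h f g = Bcontfun (\<lambda>z. h (apply_bcontfun f z) (apply_bcontfun g z))"

text \<open>A bound K for \<open>h\<close> serves twice: it shows that the pointwise product is
  bounded, so that \<open>Bcontfun\<close> can be inverted, and it bounds \<open>pointwise h\<close>
  in the uniform norm.\<close>

lemma
  assumes "bounded_bilinear h"
  shows apply_pointwise: "apply_bcontfun (pointwise h f g) z = h (apply_bcontfun f z) (apply_bcontfun g z)"
    and bounded_bilinear_pointwise: "bounded_bilinear (pointwise h)"
proof -
  interpret bounded_bilinear h by (rule assms)
  obtain K where K: "0 \<le> K" "\<And>a b. norm (h a b) \<le> norm a * norm b * K"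
    using nonneg_bounded by blast
  have le: "norm (h (apply_bcontfun f z) (apply_bcontfun g z)) \<le> norm f * norm g * K" for f g and z :: real
    by (rule order.trans[OF K(2)]) (intro mult_mono norm_bounded order.refl mult_nonneg_nonneg norm_ge_zero K(1))
  have bc: "(\<lambda>z. h (apply_bcontfun f z) (apply_bcontfun g z)) \<in> bcontfun" for f g :: "real \<Rightarrow>\<^sub>C _"
    by (rule bcontfun_normI[OF _ le]) (intro continuous_on continuous_on_apply_bcontfun)
  show ap: "apply_bcontfun (pointwise h f g) z = h (apply_bcontfun f z) (apply_bcontfun g z)" for f g z
    by (simp add: pointwise_def Bcontfun_inverse bc)
  show "bounded_bilinear (pointwise h)"
  proof
    show "\<exists>K. \<forall>a b. norm (pointwise h a b) \<le> norm a * norm b * K"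
      by (intro exI[of _ K] allI norm_bound) (simp add: ap le)
  qed (auto intro!: bcontfun_eqI simp: ap add_left add_right scaleR_left scaleR_right)
qed

section \<open>Integrals over the unit interval\<close>

lemma set_integrable_mult_continuous:
  fixes w f :: "real \<Rightarrow> real"
  assumes "set_integrable lebesgue {0..1} w" and f: "continuous_on {0..1} f"
  shows "set_integrable lebesgue {0..1} (\<lambda>z. w z * f z)"
proof -
  have "set_integrable lebesgue {0..1} (\<lambda>z. f z * w z)"
    using assms
    by (intro absolutely_integrable_bounded_measurable_product_real continuous_imp_measurable_on_sets_lebesgue
        compact_imp_bounded compact_continuous_image) auto
  then show ?thesis by (simp add: mult.commute)
qed

text \<open>The L^1 norm of the weight bounds the functional on the space with the uniform norm.
  Time derivatives then pass through the integral by linearity and boundedness.\<close>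

lemma bounded_linear_weighted_integral:
  assumes w: "set_integrable lebesgue {0..1} w"
  shows "bounded_linear (\<lambda>f :: real \<Rightarrow>\<^sub>C real. LINT z:{0..1}|lebesgue. w z * apply_bcontfun f z)"
proof (rule bounded_linear_intro[where K = "LINT z:{0..1}|lebesgue. \<bar>w z\<bar>"])
  fix f g :: "real \<Rightarrow>\<^sub>C real" and r :: real
  note [simp] = set_integrable_mult_continuous[OF w continuous_on_apply_bcontfun]
  show "(LINT z:{0..1}|lebesgue. w z * apply_bcontfun (f + g) z) =
      (LINT z:{0..1}|lebesgue. w z * apply_bcontfun f z) + (LINT z:{0..1}|lebesgue. w z * apply_bcontfun g z)"
    by (simp add: distrib_left)
  show "(LINT z:{0..1}|lebesgue. w z * apply_bcontfun (r *\<^sub>R f) z) =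
      r *\<^sub>R (LINT z:{0..1}|lebesgue. w z * apply_bcontfun f z)"
    by (simp add: mult.left_commute)
  have "norm (LINT z:{0..1}|lebesgue. w z * apply_bcontfun f z) \<le> (LINT z:{0..1}|lebesgue. \<bar>w z * apply_bcontfun f z\<bar>)"
    using set_integral_norm_bound[of lebesgue "{0..1}" "\<lambda>z. w z * apply_bcontfun f z"] by simp
  also have "\<dots> \<le> (LINT z:{0..1}|lebesgue. \<bar>w z\<bar> * norm f)"
  proof (intro set_integral_mono set_integrable_abs set_integrable_mult_left)
    show "\<bar>w z * apply_bcontfun f z\<bar> \<le> \<bar>w z\<bar> * norm f" for z
      using norm_bounded[of f z] by (simp add: abs_mult mult_left_mono)
  qed (use w in auto)
  finally show "norm (LINT z:{0..1}|lebesgue. w z * apply_bcontfun f z) \<le> norm f * (LINT z:{0..1}|lebesgue. \<bar>w z\<bar>)"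
    by (simp add: mult.commute)
qed

text \<open>The set where \<open>f\<close> is nonzero is relatively open in [0,1]. If it contained
  z, possibly an endpoint, density of (0,1) would give a nonempty open subset of (0,1), which is not
  negligible.\<close>

lemma continuous_AE_zero:
  fixes f :: "real \<Rightarrow> 'a::real_normed_vector"
  assumes f: "continuous_on {0..1} f" and AE: "AE z in lebesgue. z \<in> {0..1} \<longrightarrow> f z = 0"
    and z: "z \<in> {0..1}"
  shows "f z = 0"
proof (rule ccontr)
  assume "f z \<noteq> 0"
  have "{0..1} \<subseteq> closure {0<..<1::real}" by simp
  then have "z \<in> closure ({0<..<1} :: real set)" using z by blast
  obtain U where U: "open U" "U \<inter> {0..1} = {0..1} \<inter> f -` (- {0})"
    using continuous_on_open_invariant f by (metis open_Compl closed_singleton inf_commute)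
  then have "z \<in> U" using \<open>f z \<noteq> 0\<close> z by blast
  with \<open>z \<in> closure _\<close> \<open>open U\<close> have "U \<inter> {0<..<1} \<noteq> {}"
    by (meson closure_iff_nhds_not_empty order.refl disjoint_iff)
  then have "\<not> negligible (U \<inter> {0<..<1})"
    using U(1) by (intro open_not_negligible) auto
  moreover have "negligible (U \<inter> {0<..<1})"
  proof (rule negligible_subset)
    show "negligible {z. \<not> (z \<in> {0..1} \<longrightarrow> f z = 0)}"
      using AE by (simp add: negligible_iff_null_sets completion.AE_iff_null_sets)
    show "U \<inter> {0<..<1} \<subseteq> {z. \<not> (z \<in> {0..1} \<longrightarrow> f z = 0)}"
    proof
      fix x assume "x \<in> U \<inter> {0<..<1}"
      then have "x \<in> U \<inter> {0..1}" by auto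
      then show "x \<in> {z. \<not> (z \<in> {0..1} \<longrightarrow> f z = 0)}" unfolding U(2) by auto
    qed
  qed
  ultimately show False by simp
qed


section \<open>The metric\<close>

text \<open>Both blocks of the Maurer-Cartan form are packed into one bounded bilinear map, from
  which smoothness of the form in z follows.\<close>

lemma bounded_bilinear_block_body:
  "bounded_bilinear (\<lambda>X Y. block (rel_rot X Y) (body_velocity X Y) 0)"
proof -
  interpret r: bounded_bilinear rel_rot by (rule bounded_bilinear_rel_rot)
  interpret v: bounded_bilinear body_velocity by (rule bounded_bilinear_body_velocity)
  have add: "block (A + B) (u + v) 0 = block A u 0 + block B v 0"
    and scale: "block (c *\<^sub>R A) (c *\<^sub>R u) 0 = c *\<^sub>R block A u 0" for A B u v c
    by (simp_all add: vec_eq_iff block_def split: sum.split)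
  show ?thesis
    unfolding bilinear_conv_bounded_bilinear[symmetric] bilinear_def linear_iff
    by (simp add: r.add_left r.add_right r.scaleR_left r.scaleR_right
        v.add_left v.add_right v.scaleR_left v.scaleR_right add scale)
qed

text \<open>\<open>cinf\<close> returns the given values only for a smooth function. On tangent
  vectors the product with \<open>matrix_inv\<close> agrees with a bilinear expression in
  \<open>g\<close> and \<open>a\<close>, which is smooth.\<close>

lemma ev_maurer_cartan:
  assumes g: "g \<in> G" and a: "a \<in> tangent_G g" and z: "z \<in> {0..1}"
  shows "ev (maurer_cartan g a) z = matrix_inv (ev g z) ** ev a z"
  unfolding maurer_cartan_def
proof (rule ev_cinf[OF _ z])
  have "smooth_on {0..1} (\<lambda>z. block (rel_rot (ev g z) (ev a z)) (body_velocity (ev g z) (ev a z)) 0)"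
    by (rule smooth_on_bounded_bilinear[OF perfect_unit_interval bounded_bilinear_block_body ev_smooth_on ev_smooth_on])
  then show "smooth_on {0..1} (\<lambda>z. matrix_inv (ev g z) ** ev a z)"
    by (rule smooth_on_cong[OF perfect_unit_interval])
      (use g a in \<open>simp_all add: G_def tangent_G_def matrix_inv_tangent\<close>)
qed

text \<open>\<open>rod_metric\<close> depends on the base point and the tangent vectors only through
  \<open>maurer_cartan\<close>, so this identity yields left invariance.\<close>

lemma maurer_cartan_neutral: "maurer_cartan neutral a = a"
proof (rule cinf_eqI)
  fix z :: real assume z: "z \<in> {0..1}"
  have ev_neutral: "ev neutral x = mat 1" if "x \<in> {0..1}" for x
    unfolding neutral_def by (rule ev_cinf[OF smooth_on_const[OF perfect_unit_interval] that])
  have inv: "matrix_inv (mat 1 :: mat31) = mat 1"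
    by (rule matrix_inv_eqI) simp_all
  have "smooth_on {0..1} (\<lambda>x. matrix_inv (ev neutral x) ** ev a x)"
    by (rule smooth_on_cong[OF perfect_unit_interval ev_smooth_on[of a]]) (simp_all add: ev_neutral inv)
  then show "ev (maurer_cartan neutral a) z = ev a z"
    using z by (simp add: maurer_cartan_def ev_cinf ev_neutral inv)
qed

lemma subspace_tangent_G:
  assumes "g \<in> G"
  shows "subspace (tangent_G g)"
  using assms subspace_tangent_SE3
  by (auto simp: subspace_def tangent_G_def G_def ev_simps)

section \<open>Velocity fields along the rod\<close>

definition spin :: "mat31 cinf \<Rightarrow> mat31 cinf \<Rightarrow> real \<Rightarrow> real^3" where
  "spin g a z = body_rotation (ev g z) (ev a z)"

text \<open>The velocity of the image of \<open>ev p z\<close> under the motion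
  \<open>ev g z\<close>, expressed in the body frame.\<close>

definition point_velocity :: "(real^3) cinf \<Rightarrow> mat31 cinf \<Rightarrow> mat31 cinf \<Rightarrow> real \<Rightarrow> real^3" where
  "point_velocity p g a z = cross3 (spin g a z) (ev p z) + body_velocity (ev g z) (ev a z)"

lemma bounded_bilinear_cross3: "bounded_bilinear cross3"
  by (simp add: bilinear_conv_bounded_bilinear[symmetric] bilinear_def linear_iff cross_add_left cross_add_right
      cross_mult_left cross_mult_right)

lemma bounded_bilinear_nth_mult_nth: "bounded_bilinear (\<lambda>v w :: real^3. v $ i * w $ j)"
  by (rule bounded_bilinear.comp[OF bounded_bilinear_mult bounded_linear_vec_nth bounded_linear_vec_nth])

lemma continuous_on_spin: "continuous_on {0..1} (spin g a)"
  unfolding spin_def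
  by (intro bounded_bilinear.continuous_on[OF bounded_bilinear_body_rotation] continuous_on_ev)

lemma continuous_on_point_velocity: "continuous_on {0..1} (point_velocity p g a)"
  unfolding point_velocity_def
  by (intro continuous_on_add bounded_bilinear.continuous_on[OF bounded_bilinear_cross3]
      bounded_bilinear.continuous_on[OF bounded_bilinear_body_velocity] continuous_on_ev continuous_on_spin)

lemma spin_linear: "spin g (a + b) z = spin g a z + spin g b z" "spin g (r *\<^sub>R a) z = r *\<^sub>R spin g a z"
proof -
  interpret bounded_bilinear body_rotation by (rule bounded_bilinear_body_rotation)
  show "spin g (a + b) z = spin g a z + spin g b z" "spin g (r *\<^sub>R a) z = r *\<^sub>R spin g a z"
    by (simp_all add: spin_def ev_simps add_right scaleR_right)
qed

lemma point_velocity_linear: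
  "point_velocity p g (a + b) z = point_velocity p g a z + point_velocity p g b z"
  "point_velocity p g (r *\<^sub>R a) z = r *\<^sub>R point_velocity p g a z"
proof -
  interpret bounded_bilinear body_velocity by (rule bounded_bilinear_body_velocity)
  interpret c: bounded_bilinear cross3 by (rule bounded_bilinear_cross3)
  show "point_velocity p g (a + b) z = point_velocity p g a z + point_velocity p g b z"
    "point_velocity p g (r *\<^sub>R a) z = r *\<^sub>R point_velocity p g a z"
    by (simp_all add: point_velocity_def spin_linear ev_simps add_right scaleR_right c.add_left c.scaleR_left
        scaleR_add_right)
qed

lemma set_integrable_vec_nth:
  fixes f :: "'a \<Rightarrow> real^'n"
  assumes "set_integrable M A f"
  shows "set_integrable M A (\<lambda>x. f x $ i)"
  using integrable_bounded_linear[OF bounded_linear_vec_nth[of i] assms[unfolded set_integrable_def]]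
  by (simp add: set_integrable_def)

lemma set_integrable_sum:
  fixes f :: "'i \<Rightarrow> 'b \<Rightarrow> real"
  assumes "\<And>i. i \<in> I \<Longrightarrow> set_integrable M A (f i)"
  shows "set_integrable M A (\<lambda>x. \<Sum>i\<in>I. f i x)"
    and "(LINT x:A|M. \<Sum>i\<in>I. f i x) = (\<Sum>i\<in>I. LINT x:A|M. f i x)"
  using assms
  by (simp_all add: set_integrable_def set_lebesgue_integral_def sum_distrib_left Bochner_Integration.integral_sum)

text \<open>This separates the coefficients of the inertia operator, which are merely integrable in
  z, from the velocities, which are continuous. The inertia term becomes a finite sum of weighted
  integrals.\<close>

lemma inner_linear_expand:
  fixes f :: "real^'n \<Rightarrow> real^'m"
  assumes "linear f"
  shows "v \<bullet> f w = (\<Sum>i\<in>UNIV. \<Sum>j\<in>UNIV. f (axis j 1) $ i * (v $ i * w $ j))"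
proof -
  have "v \<bullet> f w = v \<bullet> (matrix f *v w)"
    by (simp add: matrix_works assms)
  then show ?thesis
    by (simp add: inner_vec_def matrix_vector_mult_def matrix_def sum_distrib_left mult.left_commute)
qed

section \<open>The metric for fixed mass and inertia\<close>

locale rod =
  fixes m :: "real \<Rightarrow> real" and J :: "real \<Rightarrow> real^3 \<Rightarrow> real^3" and p :: "(real^3) cinf"
  assumes mass_pos: "\<And>z. z \<in> {0..1} \<Longrightarrow> 0 < m z"
    and mass_integrable: "set_integrable lebesgue {0..1} m"
    and inertia: "\<And>z. z \<in> {0..1} \<Longrightarrow> inertia_operator (J z)"
    and inertia_integrable: "\<And>v. set_integrable lebesgue {0..1} (\<lambda>z. J z v)"
begin

text \<open>The integrand of the metric in terms of the bilinear velocities, free of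
  \<open>matrix_inv\<close> and \<open>omega\<close>.\<close>

definition density :: "mat31 cinf \<Rightarrow> mat31 cinf \<Rightarrow> mat31 cinf \<Rightarrow> real \<Rightarrow> real" where
  "density g a b z = m z * (point_velocity p g a z \<bullet> point_velocity p g b z) + spin g a z \<bullet> J z (spin g b z)"

lemma rod_metric_eq:
  assumes "g \<in> G" "a \<in> tangent_G g" "b \<in> tangent_G g"
  shows "rod_metric m J p g a b = (LINT z:{0..1}|lebesgue. density g a b z)"
  unfolding rod_metric_def Let_def
proof (rule set_lebesgue_integral_cong)
  show "\<forall>z. z \<in> {0..1} \<longrightarrow>
      m z * (act (ev (maurer_cartan g a) z) (ev p z) \<bullet> act (ev (maurer_cartan g b) z) (ev p z)) +
      omega (ev (maurer_cartan g a) z) \<bullet> J z (omega (ev (maurer_cartan g b) z)) = density g a b z"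
  proof (intro allI impI)
    fix z :: real assume z: "z \<in> {0..1}"
    then have "ev g z \<in> SE3" "ev a z \<in> tangent_SE3 (ev g z)" "ev b z \<in> tangent_SE3 (ev g z)"
      using assms by (auto simp: G_def tangent_G_def)
    then show "m z * (act (ev (maurer_cartan g a) z) (ev p z) \<bullet> act (ev (maurer_cartan g b) z) (ev p z)) +
      omega (ev (maurer_cartan g a) z) \<bullet> J z (omega (ev (maurer_cartan g b) z)) = density g a b z"
      using z assms by (simp add: ev_maurer_cartan act_body omega_body density_def point_velocity_def spin_def)
  qed
qed simp

lemma density_expand:
  assumes "z \<in> {0..1}"
  shows "density g a b z = m z * (point_velocity p g a z \<bullet> point_velocity p g b z) +
    (\<Sum>i\<in>UNIV. \<Sum>j\<in>UNIV. J z (axis j 1) $ i * (spin g a z $ i * spin g b z $ j))"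
  using inertia[OF assms] unfolding density_def inertia_operator_def
  by (intro arg_cong2[where f = "(+)"] refl inner_linear_expand) blast

lemma mass_term_integrable:
  "set_integrable lebesgue {0..1} (\<lambda>z. m z * (point_velocity p g a z \<bullet> point_velocity p g b z))"
  by (intro set_integrable_mult_continuous mass_integrable continuous_on_inner continuous_on_point_velocity)

lemma inertia_term_integrable:
  "set_integrable lebesgue {0..1} (\<lambda>z. J z (axis j 1) $ i * (spin g a z $ i * spin g b z $ j))"
  by (intro set_integrable_mult_continuous set_integrable_vec_nth inertia_integrable
     continuous_on_mult continuous_on_component continuous_on_spin)

lemma density_integrable: "set_integrable lebesgue {0..1} (density g a b)"
  \<comment> \<open>The expansion is available only on [0,1], where \<open>J z\<close> is known to
    be linear; hence the congruence on the set.\<close>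
  by (subst set_integrable_cong[OF refl refl density_expand])
    (auto intro!: set_integral_add set_integrable_sum mass_term_integrable inertia_term_integrable)

lemma integral_density_expand:
  "(LINT z:{0..1}|lebesgue. density g a b z) =
    (LINT z:{0..1}|lebesgue. m z * (point_velocity p g a z \<bullet> point_velocity p g b z)) +
    (\<Sum>i\<in>UNIV. \<Sum>j\<in>UNIV. LINT z:{0..1}|lebesgue. J z (axis j 1) $ i * (spin g a z $ i * spin g b z $ j))"
proof -
  have "(LINT z:{0..1}|lebesgue. density g a b z) = (LINT z:{0..1}|lebesgue.
      m z * (point_velocity p g a z \<bullet> point_velocity p g b z) +
      (\<Sum>i\<in>UNIV. \<Sum>j\<in>UNIV. J z (axis j 1) $ i * (spin g a z $ i * spin g b z $ j)))"
    by (rule set_lebesgue_integral_cong) (auto simp: density_expand)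
  then show ?thesis
    by (simp add: set_integral_add(2) set_integrable_sum mass_term_integrable inertia_term_integrable)
qed

section \<open>The inner product on each tangent space\<close>

lemma inner_product_on_rod_metric:
  assumes g: "g \<in> G"
  shows "inner_product_on (tangent_G g) (rod_metric m J p g)"
  unfolding inner_product_on_def
proof (intro conjI ballI allI impI)
  show sub: "subspace (tangent_G g)" by (rule subspace_tangent_G[OF g])
  note eq = rod_metric_eq[OF g]
  fix a b assume a: "a \<in> tangent_G g" and b: "b \<in> tangent_G g"
  {
    fix c assume c: "c \<in> tangent_G g"
    have "density g (a + b) c z = density g a c z + density g b c z" for z
      by (simp add: density_def spin_linear point_velocity_linear inner_add_left algebra_simps)
    then show "rod_metric m J p g (a + b) c = rod_metric m J p g a c + rod_metric m J p g b c"
      by (simp add: eq a b c subspace_add[OF sub] density_integrable)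
  }
  {
    fix r
    have "density g (r *\<^sub>R a) b z = r * density g a b z" for z
      by (simp add: density_def spin_linear point_velocity_linear algebra_simps)
    then show "rod_metric m J p g (r *\<^sub>R a) b = r * rod_metric m J p g a b"
      by (simp add: eq a b subspace_scale[OF sub])
  }
  have "density g a b z = density g b a z" if "z \<in> {0..1}" for z
    using inertia[OF that] unfolding density_def inertia_operator_def by (metis inner_commute)
  then show "rod_metric m J p g a b = rod_metric m J p g b a"
    unfolding eq[OF a b] eq[OF b a] by (intro set_lebesgue_integral_cong) auto
next
  fix a assume a: "a \<in> tangent_G g" and "a \<noteq> 0"
  have nn: "0 \<le> m z * (point_velocity p g a z \<bullet> point_velocity p g a z)" "0 \<le> spin g a z \<bullet> J z (spin g a z)"
    if "z \<in> {0..1}" for z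
    using mass_pos[OF that] inertia[OF that] by (simp, cases "spin g a z = 0") (auto simp: inertia_operator_def less_imp_le)
  \<comment> \<open>Both summands of the density are nonnegative, so both vanish. Definiteness of
    \<open>J z\<close> then kills the spin, and positivity of the mass kills the point
    velocity.\<close>
  have zero: "ev a z = 0" if z: "z \<in> {0..1}" and 0: "density g a a z = 0" for z
  proof -
    have s: "spin g a z = 0"
      using nn[OF z] 0 inertia[OF z] unfolding density_def inertia_operator_def
      by (metis add_nonneg_eq_0_iff less_irrefl)
    moreover have "point_velocity p g a z = 0"
      using nn[OF z] 0 mass_pos[OF z] unfolding density_def
      by (metis add_nonneg_eq_0_iff inner_eq_zero_iff less_irrefl mult_eq_0_iff)
    \<comment> \<open>Once the spin is zero, the point velocity reduces to the body
      velocity.\<close>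
    ultimately show ?thesis
      using g a z by (intro tangent_SE3_eq_0[of "ev g z"])
        (auto simp: G_def tangent_G_def spin_def point_velocity_def cross3_def vec_eq_iff forall_3)
  qed
  let ?f = "\<lambda>z. indicator {0..1} z *\<^sub>R density g a a z"
  have int: "integrable lebesgue ?f"
    using density_integrable by (simp add: set_integrable_def)
  have nonneg: "0 \<le> ?f z" for z
    using nn[of z] by (simp add: indicator_def density_def)
  have "integral\<^sup>L lebesgue ?f \<noteq> 0"
  proof
    assume "integral\<^sup>L lebesgue ?f = 0"
    then have "AE z in lebesgue. ?f z = 0"
      using integral_nonneg_eq_0_iff_AE[OF int] nonneg by simp
    then have "AE z in lebesgue. z \<in> {0..1} \<longrightarrow> ev a z = 0"
      by (rule eventually_mono) (auto intro: zero simp: indicator_def)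
    then have "ev a z = 0" if "z \<in> {0..1}" for z
      using that by (rule continuous_AE_zero[OF continuous_on_ev])
    then have "a = 0"
      by (intro cinf_eqI) (simp add: ev_simps)
    with \<open>a \<noteq> 0\<close> show False by simp
  qed
  moreover have "0 \<le> integral\<^sup>L lebesgue ?f"
    by (intro Bochner_Integration.integral_nonneg nonneg)
  ultimately show "0 < rod_metric m J p g a a"
    by (simp add: rod_metric_eq[OF g a a] set_lebesgue_integral_def)
qed

section \<open>Smoothness of the metric along curves\<close>

lemma smooth_on_rod_metric:
  assumes g: "smooth_curve g" and a: "smooth_curve a" and b: "smooth_curve b"
    and tangent: "\<And>t. g t \<in> G \<and> a t \<in> tangent_G (g t) \<and> b t \<in> tangent_G (g t)"
  shows "smooth_on UNIV (\<lambda>t. rod_metric m J p (g t) (a t) (b t))"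
proof -
  note bil = smooth_on_bounded_bilinear[where S = UNIV, OF _ bounded_bilinear_pointwise]
  \<comment> \<open>\<open>W c\<close> and \<open>V c\<close> are the spin and the point velocity as
    curves in the Banach space of bounded continuous functions; on [0,1] they take the same values
    as \<open>spin\<close> and \<open>point_velocity\<close>.\<close>
  define W where "W c t = pointwise body_rotation (bcf (g t)) (bcf (c t))" for c t
  define V where "V c t = pointwise cross3 (W c t) (bcf p) + pointwise body_velocity (bcf (g t)) (bcf (c t))" for c t
  have W: "smooth_on UNIV (W c)" if "smooth_curve c" for c
    unfolding W_def by (intro bil bounded_bilinear_body_rotation smooth_curve_bcf g that) simp
  have V: "smooth_on UNIV (V c)" if "smooth_curve c" for c
    unfolding V_def
    by (intro smooth_on_plus bil bounded_bilinear_body_velocity bounded_bilinear_cross3 smooth_on_const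
        smooth_curve_bcf g that W) simp_all
  have apW: "apply_bcontfun (W c t) z = spin (g t) (c t) z" if "z \<in> {0..1}" for c t z
    using that by (simp add: W_def apply_pointwise bounded_bilinear_body_rotation apply_bcf spin_def)
  have apV: "apply_bcontfun (V c t) z = point_velocity p (g t) (c t) z" if "z \<in> {0..1}" for c t z
    using that by (simp add: V_def apply_pointwise bounded_bilinear_body_velocity bounded_bilinear_cross3
        apply_bcf apW point_velocity_def)
  \<comment> \<open>Every summand is a bounded functional, with a weight independent of t, applied
    to a bounded bilinear expression in the smooth curves \<open>V\<close> and
    \<open>W\<close>.\<close>
  have "smooth_on UNIV (\<lambda>t.
     (LINT z:{0..1}|lebesgue. m z * apply_bcontfun (pointwise (\<bullet>) (V a t) (V b t)) z) +
     (\<Sum>i\<in>UNIV. \<Sum>j\<in>UNIV. LINT z:{0..1}|lebesgue. J z (axis j 1) $ i *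
        apply_bcontfun (pointwise (\<lambda>v w. v $ i * w $ j) (W a t) (W b t)) z))"
    by (intro smooth_on_plus smooth_on_sum
        smooth_on_bounded_linear[OF _ bounded_linear_weighted_integral]
        mass_integrable set_integrable_vec_nth inertia_integrable bil
        bounded_bilinear_inner bounded_bilinear_nth_mult_nth V W a b) simp_all
  moreover have "rod_metric m J p (g t) (a t) (b t) =
     (LINT z:{0..1}|lebesgue. m z * apply_bcontfun (pointwise (\<bullet>) (V a t) (V b t)) z) +
     (\<Sum>i\<in>UNIV. \<Sum>j\<in>UNIV. LINT z:{0..1}|lebesgue. J z (axis j 1) $ i *
        apply_bcontfun (pointwise (\<lambda>v w. v $ i * w $ j) (W a t) (W b t)) z)" for t
    using tangent[of t]
    by (auto simp: rod_metric_eq integral_density_expand apply_pointwise bounded_bilinear_inner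
        bounded_bilinear_nth_mult_nth apV apW intro!: arg_cong2[where f = "(+)"] sum.cong set_lebesgue_integral_cong)
  ultimately show ?thesis by simp
qed

end

theorem proposition2:
  fixes m :: "real \<Rightarrow> real"
    and J :: "real \<Rightarrow> real^3 \<Rightarrow> real^3"
    and P\<^sub>0 :: "real \<times> (real^3^3) \<Rightarrow> (real^3) \<times> (real^3^3)"
    and p\<^sub>0 :: "(real^3) cinf"
  assumes mass_pos: "\<And>z. z \<in> {0..1} \<Longrightarrow> 0 < m z"
    and mass_integrable: "set_integrable lebesgue {0..1} m"
    and inertia: "\<And>z. z \<in> {0..1} \<Longrightarrow> inertia_operator (J z)"
    and inertia_integrable: "\<And>v. set_integrable lebesgue {0..1} (\<lambda>z. J z v)"
    and reference: "reference_configuration P\<^sub>0 p\<^sub>0"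
  shows "riemannian_metric (rod_metric m J p\<^sub>0) \<and>
    (\<forall>g\<in>G. \<forall>a\<in>tangent_G g. \<forall>b\<in>tangent_G g.
       rod_metric m J p\<^sub>0 g a b =
       rod_metric m J p\<^sub>0 neutral (maurer_cartan g a) (maurer_cartan g b))"
proof -
  interpret rod m J p\<^sub>0
    using assms by unfold_locales
  show ?thesis
    using inner_product_on_rod_metric smooth_on_rod_metric
    by (auto simp: riemannian_metric_def rod_metric_def maurer_cartan_neutral)
qed

end
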